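(* Let $n\ge 1$ and $r,\ell\ge 0$ be integers, let $A\in \mathrm{SBPS}_{r,\ell}^{n\times n}$ be a symmetric banded-plus-semiseparable matrix, and let $A=QR$ be its Householder QR factorization. Then $$RQ\in \mathrm{SBPS}_{r,\ell}^{n\times n}.$$
   Context: Notation: $M[a:b,c:d]$ is the submatrix of $M$ with rows $a,\dots,b$ and columns $c,\dots,d$. $\operatorname{tril}(M,-1)$ is the strictly lower triangular part of $M$ and $\operatorname{triu}(M,1)$ its strictly upper triangular part (other entries set to zero). $\mathrm{SBM}_{\ell}^{n\times n}$ is the set of symmetric $B=(b_{kj})\in\mathbb{R}^{n\times n}$ with $b_{kj}=0$ whenever $|k-j|>\ell$. Symmetric banded-plus-semiseparable matrices: $A\in \mathrm{SBPS}_{r,\ell}^{n\times n}$ if $A=B+\operatorname{tril}(UV^\top,-1)+\operatorname{triu}(VU^\top,1)$ for some $U,V\in\mathbb{R}^{n\times r}$ and $B\in \mathrm{SBM}_{\ell}^{n\times n}$. Householder QR: set $A^{(0)}=A$. For $k=1,\dots,n-1$ let $x=A^{(k-1)}[k:n,k]\in\mathbb{R}^{n-k+1}$, $\sigma=1$ if $x_1\ge 0$ and $\sigma=-1$ if $x_1<0$, and $\alpha_k=x_1+\sigma\|x\|_2$. Let $\mathbf{y}_k\in\mathbb{R}^n$ have entries $0$ in positions $1,\dots,k-1$, entry $1$ in position $k$, and entry $x_{i-k+1}/\alpha_k$ in positions $i=k+1,\dots,n$ (if $x=0$, these last entries are taken to be $0$). Put $\tau_k=2\|\mathbf{y}_k\|_2^{-2}$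 and $A^{(k)}=(I-\tau_k\mathbf{y}_k\mathbf{y}_k^\top)A^{(k-1)}$. Then $R=A^{(n-1)}$ is upper triangular, $Q=(I-\tau_1\mathbf{y}_1\mathbf{y}_1^\top)\cdots(I-\tau_{n-1}\mathbf{y}_{n-1}\mathbf{y}_{n-1}^\top)$ is orthogonal and $A=QR$. *)

theory Defs
  imports Complex_Main "Jordan_Normal_Form.Matrix"
begin

text \<open>
  All indices are 0-based, as usual for \<^typ>\<open>real mat\<close>: the Householder step performed with
  index \<open>k\<close> below is the step \<open>k + 1\<close> of the usual 1-based description, so the steps are
  \<open>k = 0, \<dots>, n - 2\<close>.
\<close>

definition strict_tril :: "real mat \<Rightarrow> real mat" where
  "strict_tril M = mat (dim_row M) (dim_col M) (\<lambda>(i, j). if j < i then M $$ (i, j) else 0)"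

definition strict_triu :: "real mat \<Rightarrow> real mat" where
  "strict_triu M = mat (dim_row M) (dim_col M) (\<lambda>(i, j). if i < j then M $$ (i, j) else 0)"

definition SBM :: "nat \<Rightarrow> nat \<Rightarrow> real mat set" where
  "SBM n l = {B \<in> carrier_mat n n. transpose_mat B = B \<and>
     (\<forall>k<n. \<forall>j<n. \<bar>int k - int j\<bar> > int l \<longrightarrow> B $$ (k, j) = 0)}"

definition SBPS :: "nat \<Rightarrow> nat \<Rightarrow> nat \<Rightarrow> real mat set" where
  "SBPS n r l = {A. \<exists>U \<in> carrier_mat n r. \<exists>V \<in> carrier_mat n r. \<exists>B \<in> SBM n l.
     A = B + strict_tril (U * transpose_mat V) + strict_triu (V * transpose_mat U)}"

definition vec_norm2 :: "real vec \<Rightarrow> real" where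
  "vec_norm2 v = sqrt (\<Sum>i<dim_vec v. (v $ i)\<^sup>2)"

definition householder_vec :: "real mat \<Rightarrow> nat \<Rightarrow> real vec" where
  "householder_vec M k =
     (let n = dim_row M;
          x = vec (n - k) (\<lambda>i. M $$ (k + i, k));
          \<sigma> = (if x $ 0 \<ge> 0 then 1 else - 1);
          \<alpha> = x $ 0 + \<sigma> * vec_norm2 x
      in vec n (\<lambda>i. if i < k then 0
                    else if i = k then 1
                    else if x = 0\<^sub>v (n - k) then 0
                    else x $ (i - k) / \<alpha>))"

definition householder_reflector :: "real vec \<Rightarrow> real mat" where
  "householder_reflector y =
     (let \<tau> = 2 / (vec_norm2 y)\<^sup>2
      in 1\<^sub>m (dim_vec y) - \<tau> \<cdot>\<^sub>m (transpose_mat (mat_of_row y) * mat_of_row y))"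

fun householder_iter :: "real mat \<Rightarrow> nat \<Rightarrow> real mat" where
  "householder_iter A 0 = A"
| "householder_iter A (Suc k) =
     householder_reflector (householder_vec (householder_iter A k) k) * householder_iter A k"

definition householder_R :: "real mat \<Rightarrow> real mat" where
  "householder_R A = householder_iter A (dim_row A - 1)"

definition householder_Q :: "real mat \<Rightarrow> real mat" where
  "householder_Q A =
     foldr (*) (map (\<lambda>k. householder_reflector (householder_vec (householder_iter A k) k))
                    [0..<dim_row A - 1])
           (1\<^sub>m (dim_row A))"

end

theory Submission
  imports Defs
begin

text \<open>
  A symmetric matrix is in \<open>SBPS n r l\<close> iff there is \<open>U\<close> with \<open>r\<close> columns such that the part of
  each column \<open>j\<close> in the rows \<open>i > j + l\<close> lies in the column space of \<open>U\<close> restricted to these rows.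
  Vectors with this property form subspaces which increase with \<open>j\<close>, so the Householder vectors of
  \<open>A\<close>, and then the columns of \<open>Q\<close>, inherit the property with the same \<open>U\<close>, whether or not \<open>A\<close>
  is invertible. As \<open>R\<close> is upper triangular, \<open>R Q\<close> has the property with \<open>R U\<close> in place of \<open>U\<close>,
  and \<open>R Q = Q\<^sup>T A Q\<close> is symmetric.
\<close>

section \<open>Tails of vectors in a column space\<close>

text \<open>The vector is a function on indices, so that matrix columns and Householder vectors fit
  alike. For fixed \<open>U\<close> and \<open>m\<close> the condition defines a subspace; it
  weakens as \<open>m\<close> grows and is vacuous once \<open>m\<close> reaches
  \<open>dim_row U\<close>.\<close>

definition tail_in_span :: "real mat \<Rightarrow> nat \<Rightarrow> (nat \<Rightarrow> real) \<Rightarrow> bool" where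
  "tail_in_span U m f \<longleftrightarrow>
     (\<exists>z. \<forall>i. m \<le> i \<and> i < dim_row U \<longrightarrow> f i = (\<Sum>p<dim_col U. U $$ (i, p) * z p))"

lemma tail_in_span_mono:
  assumes "tail_in_span U m f" "m \<le> m'"
  shows "tail_in_span U m' f"
  using assms unfolding tail_in_span_def by (meson order_trans)

lemma tail_in_span_cong:
  assumes "tail_in_span U m f" "\<And>i. m \<le> i \<Longrightarrow> i < dim_row U \<Longrightarrow> f i = g i"
  shows "tail_in_span U m g"
  using assms unfolding tail_in_span_def by metis

lemma tail_in_span_zero:
  assumes "\<And>i. m \<le> i \<Longrightarrow> i < dim_row U \<Longrightarrow> f i = 0"
  shows "tail_in_span U m f"
  unfolding tail_in_span_def by (rule exI[of _ "\<lambda>_. 0"]) (simp add: assms)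

lemma tail_in_span_scale:
  assumes "tail_in_span U m f"
  shows "tail_in_span U m (\<lambda>i. c * f i)"
proof -
  obtain z where "\<forall>i. m \<le> i \<and> i < dim_row U \<longrightarrow> f i = (\<Sum>p<dim_col U. U $$ (i, p) * z p)"
    using assms unfolding tail_in_span_def by blast
  then show ?thesis
    unfolding tail_in_span_def
    by (intro exI[of _ "\<lambda>p. c * z p"]) (simp add: sum_distrib_left mult.left_commute)
qed

lemma tail_in_span_diff:
  assumes "tail_in_span U m f" "tail_in_span U m g"
  shows "tail_in_span U m (\<lambda>i. f i - g i)"
proof -
  obtain z where "\<forall>i. m \<le> i \<and> i < dim_row U \<longrightarrow> f i = (\<Sum>p<dim_col U. U $$ (i, p) * z p)"
    using assms(1) unfolding tail_in_span_def by blast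
  moreover obtain w where
    "\<forall>i. m \<le> i \<and> i < dim_row U \<longrightarrow> g i = (\<Sum>p<dim_col U. U $$ (i, p) * w p)"
    using assms(2) unfolding tail_in_span_def by blast
  ultimately show ?thesis
    unfolding tail_in_span_def
    by (intro exI[of _ "\<lambda>p. z p - w p"]) (simp add: sum_subtractf right_diff_distrib)
qed

section \<open>Characterisation of \<open>SBPS\<close> by column tails\<close>

lemma index_mult_mat_sum:
  assumes "M \<in> carrier_mat n m" "N \<in> carrier_mat m k" "i < n" "j < k"
  shows "(M * N) $$ (i, j) = (\<Sum>p<m. M $$ (i, p) * N $$ (p, j))"
  using assms by (auto simp: scalar_prod_def atLeast0LessThan)

text \<open>\<open>B\<close> is arbitrary within distance \<open>l\<close> of the diagonal, so the
  generators constrain a column only beyond the band. There the coefficients of column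
  \<open>j\<close> form row \<open>j\<close> of \<open>V\<close>, and symmetry settles the upper
  triangle.\<close>

lemma SBPS_iff_tails:
  "A \<in> SBPS n r l \<longleftrightarrow> A \<in> carrier_mat n n \<and> transpose_mat A = A \<and>
     (\<exists>U \<in> carrier_mat n r. \<forall>j<n. tail_in_span U (Suc (j + l)) (\<lambda>i. A $$ (i, j)))"
    (is "?L \<longleftrightarrow> ?R")
proof
  assume ?L
  then obtain U V B where U: "U \<in> carrier_mat n r" and V: "V \<in> carrier_mat n r"
    and B: "B \<in> SBM n l"
    and A: "A = B + strict_tril (U * transpose_mat V) + strict_triu (V * transpose_mat U)"
    unfolding SBPS_def by blast
  have Bc: "B \<in> carrier_mat n n" and Bs: "transpose_mat B = B"
    and B0: "\<And>k j. k < n \<Longrightarrow> j < n \<Longrightarrow> \<bar>int k - int j\<bar> > int l \<Longrightarrow> B $$ (k, j) = 0"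
    using B unfolding SBM_def by auto
  have UV: "(U * transpose_mat V) $$ (i, j) = (\<Sum>p<r. U $$ (i, p) * V $$ (j, p))"
    and VU: "(V * transpose_mat U) $$ (i, j) = (\<Sum>p<r. V $$ (i, p) * U $$ (j, p))"
    if "i < n" "j < n" for i j
    using U V that by (auto simp: scalar_prod_def atLeast0LessThan)
  have Ac: "A \<in> carrier_mat n n"
    using A Bc U V by (auto simp: strict_tril_def strict_triu_def)
  have ent: "A $$ (i, j) = B $$ (i, j) + (if j < i then (\<Sum>p<r. U $$ (i, p) * V $$ (j, p)) else 0)
      + (if i < j then (\<Sum>p<r. V $$ (i, p) * U $$ (j, p)) else 0)"
    if "i < n" "j < n" for i j
    using that A Bc U V UV VU by (simp add: strict_tril_def strict_triu_def)
  have "A $$ (j, i) = A $$ (i, j)" if "i < n" "j < n" for i j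
  proof -
    have "B $$ (j, i) = B $$ (i, j)"
      using Bs Bc that by (metis carrier_matD index_transpose_mat(1))
    then show ?thesis
      using that by (simp add: ent mult.commute)
  qed
  then have "transpose_mat A = A"
    using Ac by (intro eq_matI) auto
  moreover have "tail_in_span U (Suc (j + l)) (\<lambda>i. A $$ (i, j))" if "j < n" for j
    unfolding tail_in_span_def
  proof (intro exI[of _ "\<lambda>p. V $$ (j, p)"] allI impI)
    fix i assume i: "Suc (j + l) \<le> i \<and> i < dim_row U"
    then have "i < n" "B $$ (i, j) = 0"
      using U that by (auto intro!: B0)
    then show "A $$ (i, j) = (\<Sum>p<dim_col U. U $$ (i, p) * V $$ (j, p))"
      using i U that by (simp add: ent)
  qed
  ultimately show ?R
    using Ac U by blast
next
  assume ?R
  then obtain U where Ac: "A \<in> carrier_mat n n" and As: "transpose_mat A = A"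
    and U: "U \<in> carrier_mat n r"
    and sp: "\<And>j. j < n \<Longrightarrow> tail_in_span U (Suc (j + l)) (\<lambda>i. A $$ (i, j))"
    by blast
  have "\<forall>j. \<exists>z. j < n \<longrightarrow> (\<forall>i. Suc (j + l) \<le> i \<and> i < n \<longrightarrow> A $$ (i, j) = (\<Sum>p<r. U $$ (i, p) * z p))"
    using sp U unfolding tail_in_span_def by auto
  then obtain z where z: "\<And>i j. j < n \<Longrightarrow> Suc (j + l) \<le> i \<Longrightarrow> i < n \<Longrightarrow>
      A $$ (i, j) = (\<Sum>p<r. U $$ (i, p) * z j p)"
    by metis
  \<comment> \<open>\<open>z j\<close> represents column \<open>j\<close> only in rows beyond the
    band; elsewhere the products formed from \<open>V\<close> take uncontrolled values, which
    \<open>B = A - S\<close> absorbs.\<close>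
  define V where "V = mat n r (\<lambda>(j, p). z j p)"
  define S where "S = strict_tril (U * transpose_mat V) + strict_triu (V * transpose_mat U)"
  have V: "V \<in> carrier_mat n r"
    by (simp add: V_def)
  have S: "S \<in> carrier_mat n n"
    using U V by (auto simp: S_def strict_tril_def strict_triu_def)
  have ent: "S $$ (i, j) = (if j < i then (\<Sum>p<r. U $$ (i, p) * z j p) else 0)
      + (if i < j then (\<Sum>p<r. z i p * U $$ (j, p)) else 0)"
    if "i < n" "j < n" for i j
    using that U V
    by (auto simp: S_def strict_tril_def strict_triu_def scalar_prod_def atLeast0LessThan V_def)
  have Asym: "A $$ (j, i) = A $$ (i, j)" if "i < n" "j < n" for i j
    using As Ac that by (metis carrier_matD index_transpose_mat(1))
  have Ssym: "S $$ (j, i) = S $$ (i, j)" if "i < n" "j < n" for i j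
    using that by (simp add: ent mult.commute)
  have low: "A $$ (i, j) = S $$ (i, j)" if "i < n" "j < n" "j + l < i" for i j
    using that by (simp add: ent z)
  have "A - S \<in> SBM n l"
    unfolding SBM_def
  proof (intro CollectI conjI allI impI)
    show "transpose_mat (A - S) = A - S"
      using Ac S Asym Ssym by (intro eq_matI) auto
    fix k j assume kj: "k < n" "j < n" "\<bar>int k - int j\<bar> > int l"
    \<comment> \<open>Below the band \<open>low\<close> applies directly; above it,
      \<open>low\<close> applies to the mirrored entry.\<close>
    then have "j + l < k \<or> k + l < j"
      by linarith
    then have "A $$ (k, j) = S $$ (k, j)"
      using kj low[of k j] low[of j k] Asym[of k j] Ssym[of k j] by auto
    then show "(A - S) $$ (k, j) = 0"
      using kj Ac S by simp
  qed (use Ac S in auto)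
  moreover have "A = (A - S) + strict_tril (U * transpose_mat V) + strict_triu (V * transpose_mat U)"
    using Ac S U V
    by (intro eq_matI) (auto simp: S_def strict_tril_def strict_triu_def)
  ultimately show ?L
    unfolding SBPS_def using U V by blast
qed

section \<open>Householder reflectors and vectors\<close>

lemma householder_reflector_carrier [simp]:
  "householder_reflector y \<in> carrier_mat (dim_vec y) (dim_vec y)"
  by (auto simp: householder_reflector_def Let_def)

lemma index_householder_reflector:
  assumes "i < dim_vec y" "j < dim_vec y"
  shows "householder_reflector y $$ (i, j) =
    (if i = j then 1 else 0) - 2 / (vec_norm2 y)\<^sup>2 * (y $ i * y $ j)"
  using assms by (auto simp: householder_reflector_def Let_def scalar_prod_def mat_of_row_def)

lemma transpose_householder_reflector:
  "transpose_mat (householder_reflector y) = householder_reflector y"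
  by (rule eq_matI)
    (auto simp: index_householder_reflector carrier_matD[OF householder_reflector_carrier])

text \<open>The rank-one form of the update: each column moves by a multiple of \<open>y\<close>.
  Both the preservation of zeros and the inheritance of tails are read off from it.\<close>

lemma index_householder_reflector_mult:
  assumes "M \<in> carrier_mat (dim_vec y) m" "i < dim_vec y" "j < m"
  shows "(householder_reflector y * M) $$ (i, j) =
    M $$ (i, j) - 2 / (vec_norm2 y)\<^sup>2 * (\<Sum>p<dim_vec y. y $ p * M $$ (p, j)) * y $ i"
proof -
  have "(householder_reflector y * M) $$ (i, j) =
      (\<Sum>p<dim_vec y. householder_reflector y $$ (i, p) * M $$ (p, j))"
    using assms by (intro index_mult_mat_sum) auto
  also have "\<dots> = (\<Sum>p<dim_vec y. (if p = i then M $$ (p, j) else 0) -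
      2 / (vec_norm2 y)\<^sup>2 * (y $ p * M $$ (p, j)) * y $ i)"
    using assms by (intro sum.cong) (auto simp: index_householder_reflector algebra_simps)
  also have "\<dots> = M $$ (i, j) - 2 / (vec_norm2 y)\<^sup>2 * (\<Sum>p<dim_vec y. y $ p * M $$ (p, j)) * y $ i"
    using assms by (simp add: sum_subtractf sum_distrib_left sum_distrib_right)
  finally show ?thesis .
qed

lemma dim_householder_vec [simp]: "dim_vec (householder_vec M k) = dim_row M"
  by (simp add: householder_vec_def Let_def)

lemma householder_vec_above: "i < k \<Longrightarrow> i < dim_row M \<Longrightarrow> householder_vec M k $ i = 0"
  by (simp add: householder_vec_def Let_def)

text \<open>For tails only proportionality to the column matters, so \<open>c\<close> hides the
  scale \<open>1 / \<alpha>\<close> and the degenerate case of a zero column, where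
  \<open>c = 0\<close>.\<close>

lemma householder_vec_below:
  "\<exists>c. \<forall>i. k < i \<and> i < dim_row M \<longrightarrow> householder_vec M k $ i = c * M $$ (i, k)"
proof -
  define x where "x = vec (dim_row M - k) (\<lambda>i. M $$ (k + i, k))"
  define \<alpha> where "\<alpha> = x $ 0 + (if x $ 0 \<ge> 0 then 1 else - 1) * vec_norm2 x"
  show ?thesis
    by (rule exI[of _ "if x = 0\<^sub>v (dim_row M - k) then 0 else 1 / \<alpha>"])
      (auto simp: householder_vec_def Let_def x_def[symmetric] \<alpha>_def[symmetric],
       auto simp: x_def)
qed

text \<open>For a nonzero column part \<open>x\<close>, the scalar product of \<open>y\<close> with
  the column is \<open>s\<close> and the squared norm of \<open>y\<close> is
  \<open>2 * s / \<alpha>\<close>. Hence the multiple of \<open>y\<close> subtracted is exactly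
  \<open>\<alpha>\<close>, and \<open>\<alpha> * y $ i\<close> equals the entry to be
  cleared.\<close>

lemma householder_reflector_annihilates:
  assumes M: "M \<in> carrier_mat n n" and k: "k < i" "i < n"
  shows "(householder_reflector (householder_vec M k) * M) $$ (i, k) = 0"
proof -
  define x where "x = vec (n - k) (\<lambda>i. M $$ (k + i, k))"
  define \<sigma> :: real where "\<sigma> = (if x $ 0 \<ge> 0 then 1 else - 1)"
  define s where "s = \<sigma> * vec_norm2 x"
  define \<alpha> where "\<alpha> = x $ 0 + s"
  define y where "y = householder_vec M k"
  have dy: "dim_vec y = n"
    using M by (simp add: y_def)
  have y: "y $ p = (if p < k then 0 else if p = k then 1 else if x = 0\<^sub>v (n - k) then 0
      else x $ (p - k) / \<alpha>)" if "p < n" for p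
    using M that
    by (simp add: y_def householder_vec_def Let_def x_def \<alpha>_def s_def \<sigma>_def)
  have Mx: "M $$ (p, k) = x $ (p - k)" if "k \<le> p" "p < n" for p
  proof -
    have "k + (p - k) = p" "p - k < n - k"
      using that by auto
    then show ?thesis
      by (simp only: x_def index_vec)
  qed
  have ent: "(householder_reflector y * M) $$ (i, k) =
      M $$ (i, k) - 2 / (vec_norm2 y)\<^sup>2 * (\<Sum>p<n. y $ p * M $$ (p, k)) * y $ i"
    using index_householder_reflector_mult[of M y n i k] M dy k by simp
  show ?thesis
  proof (cases "x = 0\<^sub>v (n - k)")
    \<comment> \<open>Here \<open>y\<close> is the \<open>k\<close>-th unit vector, so the reflector
      leaves the rows below \<open>k\<close>, already zero in this column, unchanged.\<close>
    case True
    then have "M $$ (i, k) = 0" "y $ i = 0"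
      using k Mx[of i] y[of i] by auto
    then show ?thesis
      using ent y_def by simp
  next
    case False
    \<comment> \<open>\<open>t\<close> is the squared norm of the column strictly below the
      diagonal, so that \<open>s\<close> squared is \<open>x $ 0\<close> squared plus
      \<open>t\<close>.\<close>
    define t where "t = (\<Sum>p=Suc k..<n. (M $$ (p, k))\<^sup>2)"
    have split: "(\<Sum>p<n. f p) = (\<Sum>p<k. f p) + f k + (\<Sum>p=Suc k..<n. f p)" for f :: "nat \<Rightarrow> real"
    proof -
      have "sum f {0..<n} = sum f {0..<k} + sum f {k..<n}"
        using k by (intro sum.atLeastLessThan_concat[symmetric]) auto
      then show ?thesis
        using k by (simp add: sum.atLeast_Suc_lessThan lessThan_atLeast0)
    qed
    have "(\<Sum>p<n - k. (x $ p)\<^sup>2) = (\<Sum>p=k..<n. (M $$ (p, k))\<^sup>2)"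
      by (rule sum.reindex_bij_witness[of _ "\<lambda>p. p - k" "\<lambda>p. p + k"])
        (auto simp: x_def add.commute)
    also have "\<dots> = (x $ 0)\<^sup>2 + t"
      using k by (simp add: t_def sum.atLeast_Suc_lessThan Mx)
    finally have sq: "(\<Sum>p<n - k. (x $ p)\<^sup>2) = (x $ 0)\<^sup>2 + t" .
    have "t \<ge> 0"
      by (simp add: t_def sum_nonneg)
    moreover have "dim_vec x = n - k"
      by (simp add: x_def)
    ultimately have nx: "(vec_norm2 x)\<^sup>2 = (x $ 0)\<^sup>2 + t"
      by (simp add: vec_norm2_def sq)
    have nx_pos: "vec_norm2 x > 0"
    proof -
      obtain p where p: "p < n - k" "x $ p \<noteq> 0"
        using False by (auto simp: x_def vec_eq_iff)
      have "0 < (\<Sum>p<n - k. (x $ p)\<^sup>2)"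
        using p by (intro sum_pos2[of _ p]) auto
      then show ?thesis
        by (simp add: vec_norm2_def x_def)
    qed
    have s2: "s\<^sup>2 = (x $ 0)\<^sup>2 + t"
      using nx by (simp add: s_def \<sigma>_def)
    \<comment> \<open>The choice of sign prevents cancellation: \<open>s\<close> and
      \<open>x $ 0\<close> never have opposite signs, so \<open>\<alpha>\<close> is at least as
      large as the norm of \<open>x\<close> in absolute value.\<close>
    have nz: "s \<noteq> 0" "\<alpha> \<noteq> 0"
      using nx_pos by (auto simp: \<alpha>_def s_def \<sigma>_def)
    have t: "t = (s - x $ 0) * \<alpha>"
      using s2 by (simp add: \<alpha>_def algebra_simps power2_eq_square)
    have "(\<Sum>p=Suc k..<n. y $ p * M $$ (p, k)) = t / \<alpha>"
      unfolding t_def sum_divide_distrib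
      by (rule sum.cong) (auto simp: y False Mx power2_eq_square)
    then have dot: "(\<Sum>p<n. y $ p * M $$ (p, k)) = s"
      using k nz by (simp add: split y Mx t)
    have "(\<Sum>p=Suc k..<n. (y $ p)\<^sup>2) = t / \<alpha>\<^sup>2"
      unfolding t_def sum_divide_distrib
      by (rule sum.cong) (auto simp: y False Mx power_divide)
    then have "(\<Sum>p<n. (y $ p)\<^sup>2) = 1 + t / \<alpha>\<^sup>2"
      using k by (simp add: split y)
    \<comment> \<open>Inserting \<open>t\<close> gives \<open>1 + (s - x $ 0) / \<alpha>\<close>,
      and \<open>\<alpha> + s - x $ 0\<close> is \<open>2 * s\<close>.\<close>
    also have "\<dots> = 2 * s / \<alpha>"
      using nz by (simp add: t field_simps power2_eq_square) (simp add: \<alpha>_def algebra_simps)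
    finally have "(vec_norm2 y)\<^sup>2 = 2 * s / \<alpha>"
      by (metis dy real_sqrt_pow2 sum_nonneg vec_norm2_def zero_le_power2)
    then have "(householder_reflector y * M) $$ (i, k) = M $$ (i, k) - \<alpha> * y $ i"
      using ent dot nz by simp
    also have "\<dots> = 0"
      using k nz by (simp add: y False Mx)
    finally show ?thesis
      by (simp add: y_def)
  qed
qed

section \<open>The iterates and triangularity of \<open>R\<close>\<close>

lemma householder_iter_carrier:
  assumes "A \<in> carrier_mat n n"
  shows "householder_iter A k \<in> carrier_mat n n"
proof (induction k)
  case (Suc k)
  then show ?case
    using householder_reflector_carrier[of "householder_vec (householder_iter A k) k"]
    by (auto simp del: householder_reflector_carrier)
qed (use assms in simp)

lemma householder_iter_lower_zero:
  assumes A: "A \<in> carrier_mat n n"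
  shows "\<lbrakk>k < n; j < k; j < i; i < n\<rbrakk> \<Longrightarrow> householder_iter A k $$ (i, j) = 0"
proof (induction k arbitrary: i j)
  case (Suc k)
  define M where "M = householder_iter A k"
  have M: "M \<in> carrier_mat n n"
    unfolding M_def using A by (rule householder_iter_carrier)
  show ?case
  proof (cases "j = k")
    case True
    then show ?thesis
      using householder_reflector_annihilates[OF M] Suc.prems by (simp add: M_def)
  next
    case False
    then have M0: "M $$ (p, j) = 0" if "j < p" "p < n" for p
      using Suc that by (simp add: M_def)
    \<comment> \<open>Step \<open>k\<close> does not disturb an earlier column: \<open>y\<close>
      vanishes above row \<open>k\<close>, while column \<open>j < k\<close> vanishes from row
      \<open>k\<close> on, so the two are orthogonal.\<close>
    have "householder_vec M k $ p * M $$ (p, j) = 0" if "p < n" for p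
      using M M0[of p] that False Suc.prems by (cases "p < k") (auto simp: householder_vec_above)
    then have "(\<Sum>p<n. householder_vec M k $ p * M $$ (p, j)) = 0"
      by (intro sum.neutral ballI) simp
    then have "(householder_reflector (householder_vec M k) * M) $$ (i, j) = M $$ (i, j)"
      using index_householder_reflector_mult[of M "householder_vec M k" n i j] M Suc.prems by simp
    also have "\<dots> = 0"
      using Suc.prems by (intro M0)
    finally show ?thesis
      by (simp add: M_def)
  qed
qed simp

text \<open>The \<open>n - 1\<close> steps clear columns \<open>0\<close> to \<open>n - 2\<close>;
  the last column has no entry below the diagonal.\<close>

lemma householder_R_upper:
  assumes "A \<in> carrier_mat n n" "j < i" "i < n"
  shows "householder_R A $$ (i, j) = 0"
  unfolding householder_R_def using assms by (intro householder_iter_lower_zero) auto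

section \<open>Tails of the Householder vectors\<close>

lemma tail_in_span_reflector_mult:
  assumes "M \<in> carrier_mat (dim_vec y) m" "j < m" "dim_row U = dim_vec y"
    and "tail_in_span U s (\<lambda>i. M $$ (i, j))" "tail_in_span U s (\<lambda>i. y $ i)"
  shows "tail_in_span U s (\<lambda>i. (householder_reflector y * M) $$ (i, j))"
  by (rule tail_in_span_cong[OF tail_in_span_diff[OF assms(4) tail_in_span_scale[OF assms(5),
      of "2 / (vec_norm2 y)\<^sup>2 * (\<Sum>p<dim_vec y. y $ p * M $$ (p, j))"]]])
    (simp add: index_householder_reflector_mult[OF assms(1)] assms(2,3))

text \<open>Column \<open>j\<close> of the iterate \<open>k \<le> j\<close> is column
  \<open>j\<close> of \<open>A\<close> minus multiples of Householder vectors with index below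
  \<open>j\<close>. Their tails start earlier, hence remain valid from \<open>Suc (j + l)\<close>
  on. The next Householder vector is proportional to such a column below its pivot.\<close>

lemma householder_vec_tail:
  assumes A: "A \<in> carrier_mat n n" and U: "dim_row U = n"
    and sp: "\<And>j. j < n \<Longrightarrow> tail_in_span U (Suc (j + l)) (\<lambda>i. A $$ (i, j))"
    and k: "k < n"
  shows "tail_in_span U (Suc (k + l)) (\<lambda>i. householder_vec (householder_iter A k) k $ i)"
proof -
  \<comment> \<open>Stated for every \<open>k\<close>, since it serves both inside the induction and
    for the final conclusion.\<close>
  have step: "tail_in_span U (Suc (k + l)) (\<lambda>i. householder_vec (householder_iter A k) k $ i)"
    if "tail_in_span U (Suc (k + l)) (\<lambda>i. householder_iter A k $$ (i, k))" for k
  proof -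
    define M where "M = householder_iter A k"
    have M: "M \<in> carrier_mat n n"
      unfolding M_def using A by (rule householder_iter_carrier)
    \<comment> \<open>The tail starts at \<open>Suc (k + l)\<close>, strictly below row
      \<open>k\<close>, so the entry 1 at the pivot stays outside it even for
      \<open>l = 0\<close>.\<close>
    obtain c where c: "\<forall>i. k < i \<and> i < dim_row M \<longrightarrow> householder_vec M k $ i = c * M $$ (i, k)"
      using householder_vec_below by blast
    show ?thesis
      unfolding M_def[symmetric]
      by (rule tail_in_span_cong[OF tail_in_span_scale[OF that, of c]])
        (use c M U in \<open>simp add: M_def\<close>)
  qed
  have "tail_in_span U (Suc (j + l)) (\<lambda>i. householder_iter A k $$ (i, j))"
    if "k \<le> j" "j < n" for k j
    using that
  proof (induction k arbitrary: j)
    case (Suc k)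
    define M where "M = householder_iter A k"
    have M: "M \<in> carrier_mat n n"
      unfolding M_def using A by (rule householder_iter_carrier)
    have "tail_in_span U (Suc (k + l)) (\<lambda>i. householder_vec M k $ i)"
      unfolding M_def using Suc by (intro step) auto
    then have "tail_in_span U (Suc (j + l)) (\<lambda>i. householder_vec M k $ i)"
      using Suc.prems by (elim tail_in_span_mono) simp
    moreover have "tail_in_span U (Suc (j + l)) (\<lambda>i. M $$ (i, j))"
      unfolding M_def using Suc by auto
    ultimately show ?case
      unfolding householder_iter.simps M_def[symmetric]
      using M U Suc.prems(2) by (intro tail_in_span_reflector_mult[where m = n]) auto
  qed (use sp in simp)
  then show ?thesis
    using k by (intro step) simp
qed

section \<open>Products of reflectors and the factor \<open>Q\<close>\<close>

lemma foldr_mat_mult_carrier: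
  assumes "\<And>k. k \<in> set ks \<Longrightarrow> P k \<in> carrier_mat n n" "C \<in> carrier_mat n n"
  shows "foldr (*) (map P ks) C \<in> carrier_mat n n"
  using assms by (induction ks) (auto intro!: mult_carrier_mat)

text \<open>
  In a product of reflectors with increasing indices, the factors with index greater than \<open>j\<close> fix
  the \<open>j\<close>-th unit vector, so only Householder vectors with index at most \<open>j\<close> enter column \<open>j\<close>.
\<close>
lemma reflector_product_columns:
  fixes y :: "nat \<Rightarrow> real vec" and U :: "real mat"
  assumes y: "\<And>k. dim_vec (y k) = n" "\<And>k i. i < k \<Longrightarrow> i < n \<Longrightarrow> y k $ i = 0"
    and U: "dim_row U = n"
    and sp: "\<And>k. k < n \<Longrightarrow> tail_in_span U (Suc (k + l)) (\<lambda>i. y k $ i)"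
    and j: "j < n"
  defines "G \<equiv> \<lambda>ks. foldr (*) (map (\<lambda>k. householder_reflector (y k)) ks) (1\<^sub>m n)"
  shows "sorted ks \<Longrightarrow>
    ((\<forall>k\<in>set ks. j < k) \<longrightarrow> (\<forall>i<n. G ks $$ (i, j) = (if i = j then 1 else 0))) \<and>
    tail_in_span U (Suc (j + l)) (\<lambda>i. G ks $$ (i, j))"
proof (induction ks)
  case Nil
  then show ?case
    using j U by (auto simp: G_def intro!: tail_in_span_zero)
next
  case (Cons k ks)
  have G: "G ks \<in> carrier_mat n n"
    unfolding G_def using y(1) householder_reflector_carrier
    by (intro foldr_mat_mult_carrier) (metis, simp)
  have GC: "G (k # ks) = householder_reflector (y k) * G ks"
    by (simp add: G_def)
  have ent: "G (k # ks) $$ (i, j) = G ks $$ (i, j) -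
      2 / (vec_norm2 (y k))\<^sup>2 * (\<Sum>p<n. y k $ p * G ks $$ (p, j)) * y k $ i" if "i < n" for i
    unfolding GC using index_householder_reflector_mult[of "G ks" "y k" n i j] G y(1) that j by simp
  show ?case
  proof (cases "j < k")
    \<comment> \<open>Sortedness puts all later indices above \<open>j\<close> too, so column
      \<open>j\<close> of the remaining product is still the unit vector. \<open>y k\<close>
      vanishes at \<open>j\<close>, hence the new reflector fixes it, and its tail is zero.\<close>
    case True
    then have "\<forall>k'\<in>set ks. j < k'"
      using Cons.prems by auto
    then have unit: "\<forall>i<n. G ks $$ (i, j) = (if i = j then 1 else 0)"
      using Cons by auto
    then have "(\<Sum>p<n. y k $ p * G ks $$ (p, j)) = 0"
      using True j y(2) by (intro sum.neutral) auto
    then have "\<forall>i<n. G (k # ks) $$ (i, j) = (if i = j then 1 else 0)"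
      using ent unit by simp
    then show ?thesis
      using U by (auto intro!: tail_in_span_zero)
  next
    \<comment> \<open>Now \<open>k \<le> j\<close>, so the tail of \<open>y k\<close> starts no
      later than the one required, and subtracting a multiple of \<open>y k\<close> stays in the
      span. The first claim is vacuous.\<close>
    case False
    then have "tail_in_span U (Suc (j + l)) (\<lambda>i. y k $ i)"
      using j by (intro tail_in_span_mono[OF sp[of k]]) simp_all
    then have "tail_in_span U (Suc (j + l)) (\<lambda>i. G (k # ks) $$ (i, j))"
      unfolding GC using Cons G y(1) U j by (intro tail_in_span_reflector_mult) auto
    then show ?thesis
      using False by auto
  qed
qed

text \<open>The iteration multiplies \<open>A\<close> by the reflectors in the reverse of their
  order in \<open>Q\<close>. As each reflector is symmetric, that reversed product is the transpose
  of \<open>Q\<close>.\<close>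

lemma householder_R_eq:
  assumes A: "A \<in> carrier_mat n n"
  shows "householder_R A = transpose_mat (householder_Q A) * A"
proof -
  define P where "P = (\<lambda>k. householder_reflector (householder_vec (householder_iter A k) k))"
  have P: "P k \<in> carrier_mat n n" for k
    using householder_iter_carrier[OF A, of k]
      householder_reflector_carrier[of "householder_vec (householder_iter A k) k"]
    by (simp add: P_def)
  have Pt: "transpose_mat (P k) = P k" for k
    by (simp add: P_def transpose_householder_reflector)
  define G where "G = (\<lambda>m. foldr (*) (map P [0..<m]) (1\<^sub>m n))"
  \<comment> \<open>Pulling the end factor out of \<open>foldr\<close> allows the product to be
    extended on the right by the newest reflector, which becomes the leftmost factor after
    transposition.\<close>
  have foldr_C: "foldr (*) (map P ks) C = foldr (*) (map P ks) (1\<^sub>m n) * C"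
    if "C \<in> carrier_mat n n" for ks C
  proof (induction ks)
    case (Cons k ks)
    have "foldr (*) (map P ks) (1\<^sub>m n) \<in> carrier_mat n n"
      using P by (intro foldr_mat_mult_carrier) auto
    then show ?case
      using Cons P that by (simp add: assoc_mult_mat[of _ n n _ n _ n])
  qed (use that in simp)
  have G: "G m \<in> carrier_mat n n" for m
    unfolding G_def using P by (intro foldr_mat_mult_carrier) auto
  have GS: "G (Suc m) = G m * P m" for m
    using foldr_C[OF P, of "[0..<m]" m] P[of m] by (simp add: G_def)
  have "householder_iter A m = transpose_mat (G m) * A" for m
  proof (induction m)
    case (Suc m)
    have "householder_iter A (Suc m) = P m * (transpose_mat (G m) * A)"
      using Suc by (simp add: P_def)
    also have "\<dots> = transpose_mat (G m * P m) * A"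
      using P[of m] G[of m] A
      by (simp add: transpose_mult[of _ n n _ n] Pt assoc_mult_mat[of _ n n _ n _ n])
    finally show ?case
      by (simp add: GS)
  qed (use A in \<open>simp add: G_def\<close>)
  then have "householder_iter A (n - 1) = transpose_mat (G (n - 1)) * A" .
  moreover have "householder_Q A = G (n - 1)"
    using A by (simp add: householder_Q_def G_def P_def)
  ultimately show ?thesis
    using A by (simp add: householder_R_def)
qed

lemma householder_Q_carrier:
  assumes A: "A \<in> carrier_mat n n"
  shows "householder_Q A \<in> carrier_mat n n"
proof -
  have "householder_reflector (householder_vec (householder_iter A k) k) \<in> carrier_mat n n" for k
    using householder_iter_carrier[OF A, of k]
      householder_reflector_carrier[of "householder_vec (householder_iter A k) k"]
    by simp
  then show ?thesis
    unfolding householder_Q_def using A by (intro foldr_mat_mult_carrier) auto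
qed

lemma householder_Q_tail:
  assumes A: "A \<in> carrier_mat n n" and U: "dim_row U = n"
    and sp: "\<And>j. j < n \<Longrightarrow> tail_in_span U (Suc (j + l)) (\<lambda>i. A $$ (i, j))"
    and j: "j < n"
  shows "tail_in_span U (Suc (j + l)) (\<lambda>i. householder_Q A $$ (i, j))"
proof -
  define y where "y = (\<lambda>k. householder_vec (householder_iter A k) k)"
  have "dim_vec (y k) = n" for k
    using householder_iter_carrier[OF A, of k] by (simp add: y_def)
  moreover have "y k $ i = 0" if "i < k" "i < n" for k i
    using householder_iter_carrier[OF A, of k] that by (simp add: y_def householder_vec_above)
  moreover have "tail_in_span U (Suc (k + l)) (\<lambda>i. y k $ i)" if "k < n" for k
    unfolding y_def using A U sp that by (rule householder_vec_tail)
  ultimately have "tail_in_span U (Suc (j + l)) (\<lambda>i. foldr (*)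
      (map (\<lambda>k. householder_reflector (y k)) [0..<n - 1]) (1\<^sub>m n) $$ (i, j))"
    using reflector_product_columns[of y n U l j "[0..<n - 1]"] U j by simp
  then show ?thesis
    using A by (simp add: householder_Q_def y_def)
qed

section \<open>The product \<open>R Q\<close>\<close>

text \<open>Row \<open>i\<close> of \<open>R\<close> combines only rows \<open>q \<ge> i\<close> of
  \<open>M\<close>. For \<open>i \<ge> s\<close> all of these lie in the tail, where
  \<open>M\<close> is given by \<open>U\<close> and \<open>z\<close>, so the same \<open>z\<close>
  works for \<open>R * U\<close>.\<close>

lemma upper_triangular_mult_tail:
  assumes R: "R \<in> carrier_mat n n" and M: "M \<in> carrier_mat n n" and U: "U \<in> carrier_mat n r"
    and up: "\<And>i j. j < i \<Longrightarrow> i < n \<Longrightarrow> R $$ (i, j) = 0"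
    and sp: "tail_in_span U s (\<lambda>i. M $$ (i, j))" and j: "j < n"
  shows "tail_in_span (R * U) s (\<lambda>i. (R * M) $$ (i, j))"
proof -
  obtain z where z: "\<And>i. s \<le> i \<Longrightarrow> i < n \<Longrightarrow> M $$ (i, j) = (\<Sum>p<r. U $$ (i, p) * z p)"
    using sp U unfolding tail_in_span_def by auto
  have "(R * M) $$ (i, j) = (\<Sum>p<r. (R * U) $$ (i, p) * z p)" if i: "s \<le> i" "i < n" for i
  proof -
    have "(R * M) $$ (i, j) = (\<Sum>q<n. R $$ (i, q) * M $$ (q, j))"
      using R M i j by (intro index_mult_mat_sum) auto
    also have "\<dots> = (\<Sum>q<n. R $$ (i, q) * (\<Sum>p<r. U $$ (q, p) * z p))"
    proof (rule sum.cong)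
      fix q assume "q \<in> {..<n}"
      then show "R $$ (i, q) * M $$ (q, j) = R $$ (i, q) * (\<Sum>p<r. U $$ (q, p) * z p)"
        using up[of q i] z[of q] i by (cases "q < i") auto
    qed simp
    also have "\<dots> = (\<Sum>p<r. (\<Sum>q<n. R $$ (i, q) * U $$ (q, p)) * z p)"
      by (simp add: sum_distrib_left sum_distrib_right mult.assoc, rule sum.swap)
    also have "\<dots> = (\<Sum>p<r. (R * U) $$ (i, p) * z p)"
      using i index_mult_mat_sum[OF R U] by (intro sum.cong) auto
    finally show ?thesis .
  qed
  then show ?thesis
    using R U unfolding tail_in_span_def by (intro exI[of _ z]) auto
qed

theorem theorem5:
  fixes n r l :: nat and A Q R :: "real mat"
  assumes "n \<ge> 1"
    and "A \<in> SBPS n r l"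
    and "Q = householder_Q A" and "R = householder_R A"
  shows "R * Q \<in> SBPS n r l"
proof -
  obtain U where A: "A \<in> carrier_mat n n" and As: "transpose_mat A = A"
    and U: "U \<in> carrier_mat n r"
    and sp: "\<And>j. j < n \<Longrightarrow> tail_in_span U (Suc (j + l)) (\<lambda>i. A $$ (i, j))"
    using assms(2) unfolding SBPS_iff_tails by blast
  have Q: "Q \<in> carrier_mat n n"
    using householder_Q_carrier[OF A] assms(3) by simp
  have RQ: "R = transpose_mat Q * A"
    using householder_R_eq[OF A] assms by simp
  then have R: "R \<in> carrier_mat n n"
    using Q A by simp
  \<comment> \<open>After substitution the product is the congruence transform of \<open>A\<close>
    by \<open>Q\<close>, which preserves symmetry.\<close>
  have "transpose_mat (R * Q) = R * Q"
    using Q A unfolding RQ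
    by (simp add: transpose_mult[of _ n n _ n] As assoc_mult_mat[of _ n n _ n _ n])
  \<comment> \<open>The generator changes from \<open>U\<close> to \<open>R * U\<close>, but neither
    its number of columns nor the start of the tails does, so \<open>r\<close> and \<open>l\<close>
    are preserved.\<close>
  moreover have "tail_in_span (R * U) (Suc (j + l)) (\<lambda>i. (R * Q) $$ (i, j))" if "j < n" for j
  proof (rule upper_triangular_mult_tail[OF R Q U _ _ that])
    show "R $$ (i, j) = 0" if "j < i" "i < n" for i j
      using householder_R_upper[OF A that] assms by simp
    show "tail_in_span U (Suc (j + l)) (\<lambda>i. Q $$ (i, j))"
      using householder_Q_tail[OF A _ sp that] U assms(3) by simp
  qed
  ultimately show ?thesis
    unfolding SBPS_iff_tails using R Q U by (auto intro!: bexI[of _ "R * U"])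
qed

end
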